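(* Let $q$ be a prime power, and let $f\in\mathcal{LP}_q$ and $a,b\in\mathbb{F}_q$ be such that $f(a,b)=0$. Then $f$ is principal isotopic to the reduced polynomial $$\rho_{f,a,b}:=f[p_{f,a,b}+a,\,q_{f,a,b}+b]\in\mathcal{RLP}_q,$$ where $p_{f,a,b}:=(f(x+a,b))^{-1}\in\mathcal{P}_q$ and $q_{f,a,b}:=(f(a,x+b))^{-1}\in\mathcal{P}_q$.
   Context: $\mathbb{F}_q$ is the finite field with $q$ elements. $\mathcal{P}_q$ is the set of polynomials in $\mathbb{F}_q[x]$ of degree less than $q$ that act as permutations of $\mathbb{F}_q$; the inverse $g^{-1}\in\mathcal{P}_q$ of $g\in\mathcal{P}_q$ is the compositional inverse, i.e. $g(g^{-1}(x))=g^{-1}(g(x))=x$ modulo $x^q-x$. $\mathcal{LP}_q$ is the set of polynomials $f\in\mathbb{F}_q[x,y]$ of degree less than $q$ in each variable such that, for every $c\in\mathbb{F}_q$, both $f(x,c)$ and $f(c,x)$ act as permutations of $\mathbb{F}_q$. $\mathcal{RLP}_q$ is the set of reduced polynomials in $\mathcal{LP}_q$, i.e. those $f$ with $f(x,0)=x$ and $f(0,y)=y$. For $f\in\mathcal{LP}_q$ and $g,h\in\mathcal{P}_q$, $f[g,h]:=f(g(x),h(y))$, the composition being taken modulo $x^q-x$ and $y^q-y$. Two polynomials $f,g\in\mathcal{LP}_q$ are principal isotopic if $g[h_1,h_2]=f$ for some $h_1,h_2\in\mathcal{P}_q$. *)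

theory Defs
  imports
    "HOL-Computational_Algebra.Computational_Algebra"
    "HOL-Number_Theory.Cong"
    "HOL-Library.Cardinality"
begin

text \<open>
  The field with \<open>q\<close> elements is a type \<open>'a\<close> of sort \<open>{finite, field}\<close>, and \<open>q = CARD('a)\<close>.
  A polynomial \<open>f(x, y)\<close> is an element of \<open>F\<^sub>q[x][y]\<close>, i.e. of type \<open>'a poly poly\<close>:
  the outer variable is \<open>y\<close>, the coefficients are polynomials in \<open>x\<close>.
\<close>

definition eval_snd :: "'a::comm_ring_1 poly poly \<Rightarrow> 'a \<Rightarrow> 'a poly" where
  \<comment> \<open>\<open>f(x, c)\<close>, a polynomial in \<open>x\<close>\<close>
  "eval_snd f c = poly f [:c:]"

definition eval_fst :: "'a::comm_ring_1 poly poly \<Rightarrow> 'a \<Rightarrow> 'a poly" where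
  \<comment> \<open>\<open>f(c, y)\<close>, a polynomial in \<open>y\<close>\<close>
  "eval_fst f c = map_poly (\<lambda>p. poly p c) f"

definition eval2 :: "'a::comm_ring_1 poly poly \<Rightarrow> 'a \<Rightarrow> 'a \<Rightarrow> 'a" where
  "eval2 f a b = poly (eval_snd f b) a"

definition perm_polys :: "'a::{finite,field} poly set" where
  "perm_polys = {g. degree g < CARD('a) \<and> bij (poly g)}"

definition local_perm_polys :: "'a::{finite,field} poly poly set" where
  "local_perm_polys =
    {f. degree f < CARD('a) \<and> (\<forall>i. degree (coeff f i) < CARD('a)) \<and>
        (\<forall>c. bij (poly (eval_snd f c)) \<and> bij (poly (eval_fst f c)))}"

definition reduced_local_perm_polys :: "'a::{finite,field} poly poly set" where
  "reduced_local_perm_polys =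
    {f \<in> local_perm_polys. eval_snd f 0 = [:0, 1:] \<and> eval_fst f 0 = [:0, 1:]}"

definition field_poly :: "nat \<Rightarrow> 'b::comm_ring_1 poly" where
  \<comment> \<open>\<open>t^q - t\<close>; used both over \<open>F\<^sub>q\<close> (where \<open>t = x\<close>) and over \<open>F\<^sub>q[x]\<close> (where \<open>t = y\<close>)\<close>
  "field_poly q = monom 1 q - monom 1 1"

definition perm_poly_inv :: "'a::{finite,field} poly \<Rightarrow> 'a poly" where
  \<comment> \<open>compositional inverse in \<open>perm_polys\<close>; well-defined there by \<open>perm_poly_inv_ex1\<close> below\<close>
  "perm_poly_inv g =
    (THE h. h \<in> perm_polys \<and>
       [pcompose g h = [:0, 1:]] (mod (field_poly CARD('a))) \<and>
       [pcompose h g = [:0, 1:]] (mod (field_poly CARD('a))))"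

definition reduce2 :: "'a::{finite,field} poly poly \<Rightarrow> 'a poly poly" where
  \<comment> \<open>The remainder modulo \<open>x^q - x\<close> and \<open>y^q - y\<close>. As \<open>y^q - y\<close> is monic, pseudo-division by it
    in \<open>F\<^sub>q[x][y]\<close> is ordinary division with remainder; see \<open>reduce2_correct\<close> below.\<close>
  "reduce2 f =
    map_poly (\<lambda>p. p mod field_poly CARD('a))
      (pseudo_mod f (field_poly CARD('a)))"

definition subst2 :: "'a::{finite,field} poly poly \<Rightarrow> 'a poly \<Rightarrow> 'a poly \<Rightarrow> 'a poly poly" where
  \<comment> \<open>\<open>f(g(x), h(y))\<close>, not yet reduced\<close>
  "subst2 f g h = pcompose (map_poly (\<lambda>p. pcompose p g) f) (map_poly (\<lambda>c. [:c:]) h)"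

definition isotope :: "'a::{finite,field} poly poly \<Rightarrow> 'a poly \<Rightarrow> 'a poly \<Rightarrow> 'a poly poly" where
  \<comment> \<open>\<open>f[g, h]\<close>\<close>
  "isotope f g h = reduce2 (subst2 f g h)"

definition principal_isotopic :: "'a::{finite,field} poly poly \<Rightarrow> 'a poly poly \<Rightarrow> bool" where
  "principal_isotopic f g \<longleftrightarrow>
    f \<in> local_perm_polys \<and> g \<in> local_perm_polys \<and>
    (\<exists>h1 \<in> perm_polys. \<exists>h2 \<in> perm_polys. isotope g h1 h2 = f)"

definition pinv :: "'a::{finite,field} poly poly \<Rightarrow> 'a \<Rightarrow> 'a \<Rightarrow> 'a poly" where
  \<comment> \<open>\<open>p\<^bsub>f,a,b\<^esub> = (f(x + a, b))\<^sup>-\<^sup>1\<close>\<close>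
  "pinv f a b = perm_poly_inv (pcompose (eval_snd f b) [:a, 1:])"

definition qinv :: "'a::{finite,field} poly poly \<Rightarrow> 'a \<Rightarrow> 'a \<Rightarrow> 'a poly" where
  \<comment> \<open>\<open>q\<^bsub>f,a,b\<^esub> = (f(a, x + b))\<^sup>-\<^sup>1\<close>\<close>
  "qinv f a b = perm_poly_inv (pcompose (eval_fst f a) [:b, 1:])"

definition rho :: "'a::{finite,field} poly poly \<Rightarrow> 'a \<Rightarrow> 'a \<Rightarrow> 'a poly poly" where
  "rho f a b = isotope f (pinv f a b + [:a:]) (qinv f a b + [:b:])"

lemma card_field_gt_1: "CARD('a::{finite,field}) > 1"
proof -
  have "card {0, 1::'a} \<le> CARD('a)" by (rule card_mono) auto
  then show ?thesis by simp
qed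

lemma field_poly_props:
  assumes "q > 1"
  shows "degree (field_poly q :: 'b::{comm_ring_1} poly) = q"
    and "coeff (field_poly q :: 'b poly) q = 1"
    and "(field_poly q :: 'b poly) \<noteq> 0"
proof -
  show c: "coeff (field_poly q :: 'b poly) q = 1"
    using assms by (simp add: field_poly_def)
  show "degree (field_poly q :: 'b poly) = q"
  proof (rule antisym)
    show "degree (field_poly q :: 'b poly) \<le> q"
      using assms by (intro degree_le) (auto simp: field_poly_def)
    show "q \<le> degree (field_poly q :: 'b poly)"
      by (rule le_degree) (simp add: c)
  qed
  show "(field_poly q :: 'b poly) \<noteq> 0" using c by force
qed

lemma reduce2_correct:
  fixes f :: "'a::{finite,field} poly poly"
  defines "X \<equiv> [:field_poly CARD('a):]" and "Y \<equiv> field_poly CARD('a)"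
  shows "degree (reduce2 f) < CARD('a)"
    and "\<forall>i. degree (coeff (reduce2 f) i) < CARD('a)"
    and "\<exists>u v. f = reduce2 f + X * u + Y * v"
proof -
  note q = card_field_gt_1[where 'a = 'a]
  define m :: "'a poly" where "m = field_poly CARD('a)"
  have m: "degree m = CARD('a)" "m \<noteq> 0"
    using field_poly_props[OF q, where 'b = 'a] by (auto simp: m_def)
  have Y: "degree Y = CARD('a)" "coeff Y CARD('a) = 1" "Y \<noteq> 0"
    using field_poly_props[OF q, where 'b = "'a poly"] by (auto simp: Y_def)
  obtain v r where vr: "pseudo_divmod f Y = (v, r)" by force
  have r: "f = Y * v + r" "r = 0 \<or> degree r < degree Y"
    using pseudo_divmod[OF Y(3) vr] by (simp_all add: Y)
  have red: "reduce2 f = map_poly (\<lambda>p. p mod m) r"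
    using vr by (simp add: reduce2_def pseudo_mod_def Y_def m_def)
  have dr: "degree r < CARD('a)" using r(2) Y q by auto
  show "degree (reduce2 f) < CARD('a)"
    unfolding red by (rule le_less_trans[OF degree_le dr]) (auto simp: coeff_map_poly coeff_eq_0)
  show "\<forall>i. degree (coeff (reduce2 f) i) < CARD('a)"
  proof
    fix i
    have "coeff (reduce2 f) i = coeff r i mod m"
      by (simp add: red coeff_map_poly)
    then show "degree (coeff (reduce2 f) i) < CARD('a)"
      using degree_mod_less[OF m(2), of "coeff r i"] m q by auto
  qed
  have "r = reduce2 f + X * map_poly (\<lambda>p. p div m) r"
    by (rule poly_eqI) (simp add: red X_def coeff_map_poly flip: m_def)
  then have "f = reduce2 f + X * map_poly (\<lambda>p. p div m) r + Y * v"
    using r(1) by (simp add: algebra_simps)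
  then show "\<exists>u v. f = reduce2 f + X * u + Y * v" by blast
qed

lemma field_poly_eval:
  "poly (field_poly CARD('a)) c = (0::'a::{finite,field})"
proof (cases "c = 0")
  case True
  then show ?thesis
    using card_field_gt_1[where 'a = 'a] by (simp add: field_poly_def poly_monom power_0_left)
next
  case False
  let ?U = "UNIV - {0::'a}"
  have inj: "inj_on ((*) c) ?U" using False by (auto simp: inj_on_def)
  have im: "(*) c ` ?U = ?U"
    by (rule endo_inj_surj) (use False inj in auto)
  have "prod id ?U = prod ((*) c) ?U"
    using prod.reindex[OF inj, of id] im by (simp add: o_def)
  also have "\<dots> = c ^ card ?U * prod id ?U" by (simp add: prod.distrib)
  finally have "c ^ (CARD('a) - 1) = 1" by (simp add: card_Diff_singleton)
  then have "c ^ Suc (CARD('a) - 1) = c" by (simp only: power_Suc mult_1_right)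
  then show ?thesis
    using card_field_gt_1[where 'a = 'a] by (simp add: field_poly_def poly_monom)
qed

lemma cong_field_poly_iff:
  fixes g h :: "'a::{finite,field} poly"
  shows "[g = h] (mod (field_poly CARD('a))) \<longleftrightarrow> poly g = poly h"
proof
  let ?m = "field_poly CARD('a) :: 'a poly"
  note q = card_field_gt_1[where 'a = 'a]
  note m = field_poly_props[OF q, where 'b = 'a]
  have ev: "poly (p mod ?m) c = poly p c" for p c
  proof -
    have "poly p c = poly (p div ?m * ?m + p mod ?m) c" by (simp only: div_mult_mod_eq)
    then show ?thesis by (simp only: poly_add poly_mult field_poly_eval) simp
  qed
  have deg: "degree (p mod ?m) < CARD('a)" for p
    using degree_mod_less[OF m(3), of p] m(1) q by auto
  show "poly g = poly h" if "[g = h] (mod ?m)"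
    using that ev unfolding cong_def by (metis ext)
  show "[g = h] (mod ?m)" if "poly g = poly h"
    unfolding cong_def
    by (rule poly_eqI_degree[of UNIV]) (use that ev deg in auto)
qed

lemma perm_poly_inv_ex1:
  fixes g :: "'a::{finite,field} poly"
  assumes "g \<in> perm_polys"
  shows "\<exists>!h. h \<in> perm_polys \<and>
       [pcompose g h = [:0, 1:]] (mod (field_poly CARD('a))) \<and>
       [pcompose h g = [:0, 1:]] (mod (field_poly CARD('a)))"
proof -
  let ?F = "inv (poly g)"
  have bij: "bij (poly g)" using assms by (simp add: perm_polys_def)
  define L :: "'a \<Rightarrow> 'a poly" where
    "L c = (\<Prod>d\<in>UNIV - {c}. smult (1 / (c - d)) [:- d, 1:])" for c
  have Lev: "poly (L c) x = (if x = c then 1 else 0)" for c x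
  proof (cases "x = c")
    case True
    then show ?thesis by (auto simp: L_def poly_prod intro!: prod.neutral simp flip: diff_divide_distrib)
  next
    case False
    then have "\<exists>d\<in>UNIV - {c}. poly (smult (1 / (c - d)) [:- d, 1:]) x = 0"
      by (intro bexI[of _ x]) auto
    then show ?thesis using False by (auto simp: L_def poly_prod)
  qed
  define h where "h = (\<Sum>c\<in>UNIV. smult (?F c) (L c)) mod field_poly CARD('a)"
  have "[h = (\<Sum>c\<in>UNIV. smult (?F c) (L c))] (mod field_poly CARD('a))"
    by (simp add: h_def cong_def)
  then have "poly h x = ?F x" for x
    by (simp add: cong_field_poly_iff poly_sum Lev if_distrib cong: if_cong)
  then have hF: "poly h = ?F" by blast
  have degh: "degree h < CARD('a)"
    using degree_mod_less field_poly_props[OF card_field_gt_1[where 'a = 'a], where 'b = 'a]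
    unfolding h_def by (metis card_field_gt_1 degree_0 less_trans zero_less_one)
  show ?thesis
  proof (rule ex1I[of _ h])
    show "h \<in> perm_polys \<and>
       [pcompose g h = [:0, 1:]] (mod (field_poly CARD('a))) \<and>
       [pcompose h g = [:0, 1:]] (mod (field_poly CARD('a)))"
      using bij degh by (auto simp: perm_polys_def hF bij_imp_bij_inv cong_field_poly_iff
          poly_pcompose fun_eq_iff bij_is_surj surj_f_inv_f bij_is_inj)
  next
    fix k assume k: "k \<in> perm_polys \<and>
       [pcompose g k = [:0, 1:]] (mod (field_poly CARD('a))) \<and>
       [pcompose k g = [:0, 1:]] (mod (field_poly CARD('a)))"
    then have "poly g (poly k x) = x" for x
      by (auto simp: cong_field_poly_iff poly_pcompose fun_eq_iff)
    then have "poly k x = poly h x" for x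
      using bij by (metis hF bij_is_inj inv_f_f)
    then show "k = h"
      using k degh by (intro poly_eqI_degree[of UNIV]) (auto simp: perm_polys_def)
  qed
qed

end

theory Submission
  imports Defs
begin

text \<open>
  A polynomial of degree less than \<open>q\<close> in each variable is determined by its values, so every
  identity can be checked on \<open>F\<^sub>q \<times> F\<^sub>q\<close>. There, \<open>\<rho>(x, y) = f(p(x) + a, q(y) + b)\<close>, and \<open>f(a, b) = 0\<close>
  forces \<open>p(0) = q(0) = 0\<close>; hence \<open>\<rho>(x, 0) = f(p(x) + a, b) = x\<close>, and symmetrically in \<open>y\<close>.
  Substituting the inverses of \<open>p + a\<close> and \<open>q + b\<close> into \<open>\<rho>\<close> gives back \<open>f\<close>.
\<close>

lemma poly_eval_snd: "poly (eval_snd f c) x = eval2 f x c"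
  by (simp add: eval2_def)

text \<open>\<open>eval2\<close> is defined through \<open>eval_snd\<close>; evaluating in the other
  order gives the same value, so both families of specialisations can be handled through
  \<open>eval2\<close> alone.\<close>

lemma poly_eval_fst: "poly (eval_fst f c) y = eval2 f c y"
proof (induction f)
  case (pCons p f)
  then show ?case
    by (simp add: eval_fst_def eval2_def eval_snd_def map_poly_pCons)
qed (simp add: eval_fst_def eval2_def eval_snd_def)

lemma eval2_add: "eval2 (f + g) x y = eval2 f x y + eval2 g x y"
  by (simp add: eval2_def eval_snd_def)

lemma eval2_mult: "eval2 (f * g) x y = eval2 f x y * eval2 g x y"
  by (simp add: eval2_def eval_snd_def)

lemma eval2_const: "eval2 [:p:] x y = poly p x"
  by (simp add: eval2_def eval_snd_def)

lemma eval2_field_poly: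
  fixes x y :: "'a::{finite,field}"
  shows "eval2 (field_poly CARD('a)) x y = 0"
proof -
  have "eval2 (field_poly CARD('a)) x y = poly (field_poly CARD('a)) y"
    by (simp add: eval2_def eval_snd_def field_poly_def poly_monom)
  then show ?thesis by (simp add: field_poly_eval)
qed

text \<open>Reduction changes \<open>f\<close> only by multiples of \<open>x^q - x\<close> and
  \<open>y^q - y\<close>, which vanish at every point of the plane.\<close>

lemma eval2_reduce2:
  fixes f :: "'a::{finite,field} poly poly"
  shows "eval2 (reduce2 f) x y = eval2 f x y"
proof -
  obtain u v where
    f: "f = reduce2 f + [:field_poly CARD('a):] * u + field_poly CARD('a) * v"
    using reduce2_correct(3) by blast
  have "eval2 f x y =
      eval2 (reduce2 f + [:field_poly CARD('a):] * u + field_poly CARD('a) * v) x y"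
    using f by simp
  also have "\<dots> = eval2 (reduce2 f) x y"
    by (simp only: eval2_add eval2_mult eval2_const eval2_field_poly field_poly_eval) simp
  finally show ?thesis by simp
qed

lemma eval2_subst2:
  fixes f :: "'a::{finite,field} poly poly"
  shows "eval2 (subst2 f g h) x y = eval2 f (poly g x) (poly h y)"
proof -
  have const: "poly (map_poly (\<lambda>c. [:c:]) h) [:y:] = [:poly h y:]"
    by (induction h) (simp_all add: map_poly_pCons)
  \<comment> \<open>Substituting \<open>g\<close> for x commutes with setting y to a constant, since
    \<open>pcompose\<close> is a ring homomorphism in its first argument and fixes
    constants.\<close>
  have "poly (map_poly (\<lambda>p. pcompose p g) f) [:z:] = pcompose (poly f [:z:]) g" for z
    by (induction f) (simp_all add: map_poly_pCons pcompose_add pcompose_mult pcompose_smult)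
  then show ?thesis
    by (simp add: eval2_def eval_snd_def subst2_def poly_pcompose const)
qed

lemma eval2_isotope: "eval2 (isotope f g h) x y = eval2 f (poly g x) (poly h y)"
  by (simp add: isotope_def eval2_reduce2 eval2_subst2)

text \<open>\<open>f(x, c)\<close> is a linear combination over the field of the coefficients of
  \<open>f\<close>, so it inherits their degree bound.\<close>

lemma degree_eval_snd_less:
  assumes "\<And>i. degree (coeff f i) < n"
  shows "degree (eval_snd f c) < n"
  unfolding eval_snd_def poly_altdef
proof (rule degree_sum_less)
  show "degree (coeff f i * [:c:] ^ i) < n" for i
    using assms[of i] by (simp add: poly_const_pow mult.commute[of _ "[:_:]"])
      (meson degree_smult_le le_less_trans)
  show "0 < n" using assms[of 0] by simp
qed

lemma degree_eval_fst_le: "degree (eval_fst f c) \<le> degree f"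
  unfolding eval_fst_def by (rule degree_le) (simp add: coeff_map_poly coeff_eq_0)

text \<open>Univariate uniqueness is applied twice. For fixed c, \<open>f(x, c)\<close> and
  \<open>g(x, c)\<close> have degree below q and agree at all q points, hence coincide. So
  \<open>f\<close> and \<open>g\<close>, as polynomials in y over the domain of polynomials in x,
  agree at the q constants \<open>[:c:]\<close>, more points than either degree.\<close>

lemma eval2_eqI:
  fixes f g :: "'a::{finite,field} poly poly"
  assumes "degree f < CARD('a)" and "\<And>i. degree (coeff f i) < CARD('a)"
    and "degree g < CARD('a)" and "\<And>i. degree (coeff g i) < CARD('a)"
    and "\<And>x y. eval2 f x y = eval2 g x y"
  shows "f = g"
proof (rule poly_eqI_degree[of "range (\<lambda>c. [:c:])"])
  show "poly f p = poly g p" if p: "p \<in> range (\<lambda>c. [:c:])" for p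
  proof -
    obtain c where c: "p = [:c:]" using p by blast
    have "eval_snd f c = eval_snd g c"
      by (rule poly_eqI_degree[of UNIV])
        (use assms in \<open>auto simp: poly_eval_snd intro: degree_eval_snd_less\<close>)
    then show ?thesis by (simp add: eval_snd_def c)
  qed
  have "card (range (\<lambda>c::'a. [:c:])) = CARD('a)"
    by (rule card_image) (auto simp: inj_on_def)
  then show "degree f < card (range (\<lambda>c::'a. [:c:]))" "degree g < card (range (\<lambda>c::'a. [:c:]))"
    using assms by auto
qed

lemma local_perm_polys_iff:
  fixes f :: "'a::{finite,field} poly poly"
  shows "f \<in> local_perm_polys \<longleftrightarrow>
    degree f < CARD('a) \<and> (\<forall>i. degree (coeff f i) < CARD('a)) \<and>
    (\<forall>c. bij (\<lambda>x. eval2 f x c) \<and> bij (eval2 f c))"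
proof -
  have "poly (eval_snd f c) = (\<lambda>x. eval2 f x c)" "poly (eval_fst f c) = eval2 f c" for c
    by (auto simp: poly_eval_snd poly_eval_fst)
  then show ?thesis by (simp add: local_perm_polys_def)
qed

lemma isotope_in_local_perm_polys:
  fixes f :: "'a::{finite,field} poly poly"
  assumes "f \<in> local_perm_polys" and "g \<in> perm_polys" and "h \<in> perm_polys"
  shows "isotope f g h \<in> local_perm_polys"
proof -
  \<comment> \<open>Each univariate section of \<open>f\<close> is precomposed with a permutation.
    Taking c to be \<open>poly h c\<close> or \<open>poly g c\<close> then gives the sections of the
    isotope.\<close>
  have "bij (\<lambda>x. eval2 f (poly g x) c)" "bij (\<lambda>y. eval2 f c (poly h y))" for c
    using assms bij_comp[of "poly g" "\<lambda>x. eval2 f x c"] bij_comp[of "poly h" "eval2 f c"]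
    by (auto simp: local_perm_polys_iff perm_polys_def o_def)
  then have "bij (\<lambda>x. eval2 (isotope f g h) x c) \<and> bij (eval2 (isotope f g h) c)" for c
    by (simp add: eval2_isotope[abs_def])
  then show ?thesis
    using reduce2_correct(1,2)[of "subst2 f g h"]
    by (simp add: local_perm_polys_iff isotope_def)
qed

text \<open>Unique existence unfolds the description operator, and congruence modulo
  \<open>x^q - x\<close> is equality of values.\<close>

lemma perm_poly_inv:
  fixes g :: "'a::{finite,field} poly"
  assumes "g \<in> perm_polys"
  shows perm_poly_inv_in_perm_polys: "perm_poly_inv g \<in> perm_polys"
    and poly_perm_poly_inv: "poly g (poly (perm_poly_inv g) x) = x"
    and poly_perm_poly_inv': "poly (perm_poly_inv g) (poly g x) = x"
  using theI'[OF perm_poly_inv_ex1[OF assms], folded perm_poly_inv_def]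
  by (auto simp: cong_field_poly_iff poly_pcompose fun_eq_iff)

lemma perm_polys_translate_arg:
  fixes g :: "'a::{finite,field} poly"
  assumes "degree g < CARD('a)" and "bij (poly g)"
  shows "pcompose g [:a, 1:] \<in> perm_polys"
proof -
  have "bij (\<lambda>x. poly g (a + x))"
    using bij_comp[OF bij_plus_right[of a] assms(2)] by (simp add: o_def add.commute)
  moreover have "poly (pcompose g [:a, 1:]) = (\<lambda>x. poly g (a + x))"
    by (auto simp: poly_pcompose)
  ultimately show ?thesis
    using assms(1) by (simp add: perm_polys_def degree_pcompose)
qed

lemma perm_polys_translate_value:
  fixes g :: "'a::{finite,field} poly"
  assumes "g \<in> perm_polys"
  shows "g + [:a:] \<in> perm_polys"
proof -
  have "bij (\<lambda>x. a + poly g x)"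
    using assms bij_comp[OF _ bij_plus_right[of a], of "poly g"]
    by (simp add: perm_polys_def o_def add.commute)
  moreover have "poly (g + [:a:]) = (\<lambda>x. a + poly g x)" by (auto simp: add.commute)
  ultimately show ?thesis
    using assms by (simp add: perm_polys_def degree_add_less)
qed

text \<open>Supplies the witnesses for principal isotopy: on values, both substitutions cancel by
  \<open>poly_perm_poly_inv\<close>, and the degree bounds lift this to equality of
  polynomials.\<close>

lemma isotope_perm_poly_inv:
  fixes f :: "'a::{finite,field} poly poly"
  assumes "f \<in> local_perm_polys" and "g \<in> perm_polys" and "h \<in> perm_polys"
  shows "isotope (isotope f g h) (perm_poly_inv g) (perm_poly_inv h) = f"
    (is "isotope ?r ?g ?h = f")
proof (rule eval2_eqI)
  have "isotope ?r ?g ?h \<in> local_perm_polys"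
    using assms by (intro isotope_in_local_perm_polys perm_poly_inv_in_perm_polys)
  then show "degree (isotope ?r ?g ?h) < CARD('a)"
      "degree (coeff (isotope ?r ?g ?h) i) < CARD('a)" for i
    by (simp_all add: local_perm_polys_iff)
  show "degree f < CARD('a)" "degree (coeff f i) < CARD('a)" for i
    using assms(1) by (simp_all add: local_perm_polys_iff)
  show "eval2 (isotope ?r ?g ?h) x y = eval2 f x y" for x y
    using assms by (simp add: eval2_isotope poly_perm_poly_inv)
qed

lemma reduced_local_perm_polysI:
  fixes f :: "'a::{finite,field} poly poly"
  assumes "f \<in> local_perm_polys" and "\<And>x. eval2 f x 0 = x" and "\<And>y. eval2 f 0 y = y"
  shows "f \<in> reduced_local_perm_polys"
proof -
  have deg: "degree f < CARD('a)" "\<And>i. degree (coeff f i) < CARD('a)"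
    using assms(1) by (auto simp: local_perm_polys_iff)
  have "eval_snd f 0 = [:0, 1:]"
    \<comment> \<open>Both sides have degree below q, as \<open>1 < q\<close> covers
      \<open>[:0, 1:]\<close>, and they agree at all q points.\<close>
    by (rule poly_eqI_degree[of UNIV])
      (use assms deg card_field_gt_1[where 'a = 'a] in
        \<open>auto simp: poly_eval_snd intro: degree_eval_snd_less\<close>)
  moreover have "eval_fst f 0 = [:0, 1:]"
    by (rule poly_eqI_degree[of UNIV])
      (use assms deg card_field_gt_1[where 'a = 'a] in
        \<open>auto simp: poly_eval_fst intro: le_less_trans[OF degree_eval_fst_le]\<close>)
  ultimately show ?thesis using assms(1) by (simp add: reduced_local_perm_polys_def)
qed

theorem proposition4p4:
  fixes f :: "'a::{finite,field} poly poly" and a b :: 'a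
  assumes "f \<in> local_perm_polys" and "eval2 f a b = 0"
  shows "pinv f a b \<in> perm_polys \<and> qinv f a b \<in> perm_polys \<and>
         rho f a b \<in> reduced_local_perm_polys \<and>
         principal_isotopic f (rho f a b)"
proof -
  let ?F = "pcompose (eval_snd f b) [:a, 1:]" and ?G = "pcompose (eval_fst f a) [:b, 1:]"
  let ?p = "pinv f a b + [:a:]" and ?q = "qinv f a b + [:b:]"
  have f: "degree f < CARD('a)" "\<And>i. degree (coeff f i) < CARD('a)"
    "\<And>c. bij (poly (eval_snd f c))" "\<And>c. bij (poly (eval_fst f c))"
    using assms(1) by (auto simp: local_perm_polys_def)
  have F: "?F \<in> perm_polys"
    using f by (intro perm_polys_translate_arg degree_eval_snd_less) auto
  have G: "?G \<in> perm_polys"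
    using f le_less_trans[OF degree_eval_fst_le] by (intro perm_polys_translate_arg) auto
  note perm = perm_poly_inv_in_perm_polys[OF F, folded pinv_def]
    perm_poly_inv_in_perm_polys[OF G, folded qinv_def]
  note pq = perm_polys_translate_value[OF perm(1), of a] perm_polys_translate_value[OF perm(2), of b]
  have p: "eval2 f (poly ?p x) b = x" for x
    using poly_perm_poly_inv[OF F, of x]
    by (simp add: pinv_def poly_pcompose poly_eval_snd add.commute)
  have q: "eval2 f a (poly ?q y) = y" for y
    using poly_perm_poly_inv[OF G, of y]
    by (simp add: qinv_def poly_pcompose poly_eval_fst add.commute)
  \<comment> \<open>Both values are \<open>f(a, b)\<close>. Hence the inverses fix 0, and the
    shifted polynomials send 0 to a and b.\<close>
  have "poly ?F 0 = 0" "poly ?G 0 = 0"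
    using assms(2) by (simp_all add: poly_pcompose poly_eval_snd poly_eval_fst)
  then have p0: "poly ?p 0 = a" and q0: "poly ?q 0 = b"
    using poly_perm_poly_inv'[OF F, of 0] poly_perm_poly_inv'[OF G, of 0]
    by (simp_all add: pinv_def qinv_def)
  have rho: "rho f a b \<in> local_perm_polys"
    unfolding rho_def using assms(1) pq by (rule isotope_in_local_perm_polys)
  have "rho f a b \<in> reduced_local_perm_polys"
    using rho p q by (intro reduced_local_perm_polysI) (simp_all only: rho_def eval2_isotope p0 q0)
  \<comment> \<open>The definition asks for a substitution taking \<open>rho f a b\<close> back to
    \<open>f\<close>, so the witnesses are the inverses of \<open>?p\<close> and
    \<open>?q\<close>.\<close>
  moreover have "principal_isotopic f (rho f a b)"
    unfolding principal_isotopic_def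
    using assms(1) rho isotope_perm_poly_inv[OF assms(1) pq, folded rho_def]
      perm_poly_inv_in_perm_polys pq by blast
  ultimately show ?thesis using perm by blast
qed

end
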